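(* Let $f_{\min}\in\mathbb{R}$ and let $\mathcal{X}=[\mu^L,\mu^U]\times[\sigma^L,\sigma^U]\subset\mathbb{R}\times[0,\infty)$ be a box with $\mathcal{X}\subset I_2\cup I_4$. Define $f_{\sigma^L}:[\mu^L,\mu^U]\to[0,1]$ by $f_{\sigma^L}(\mu)=\mathrm{PI}(\mu,\sigma^L)$ and $f_{\mu^U}:[\sigma^L,\sigma^U]\to[0,1]$ by $f_{\mu^U}(\sigma)=\mathrm{PI}(\mu^U,\sigma)$, and let $f^{cv}_{\sigma^L}$ and $f^{cv}_{\mu^U}$ be the convex envelopes of $f_{\sigma^L}$ on $[\mu^L,\mu^U]$ and of $f_{\mu^U}$ on $[\sigma^L,\sigma^U]$, respectively. Then $$\mathrm{PI}^{cv}_{2,4}(\mu,\sigma):=\max\left(f^{cv}_{\sigma^L}(\mu),\,f^{cv}_{\mu^U}(\sigma)\right)$$ is a convex relaxation of $\mathrm{PI}$ on $\mathcal{X}$: it is convex on $\mathcal{X}$ and $\mathrm{PI}^{cv}_{2,4}(\mu,\sigma)\le\mathrm{PI}(\mu,\sigma)$ for all $(\mu,\sigma)\in\mathcal{X}$.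
   Context: The probability of improvement function $\mathrm{PI}:\mathbb{R}\times[0,\infty)\to\mathbb{R}$ with target $f_{\min}\in\mathbb{R}$ is $$\mathrm{PI}(\mu,\sigma)=\begin{cases}\Phi\!\left(\frac{f_{\min}-\mu}{\sigma}\right), & \sigma>0,\\ 0, & \sigma=0,\ f_{\min}\le\mu,\\ 1, & \sigma=0,\ f_{\min}>\mu,\end{cases}$$ where $\Phi(x)=\int_{-\infty}^x\frac{1}{\sqrt{2\pi}}e^{-t^2/2}\,dt$. The sets are subsets of $\mathbb{R}\times[0,\infty)$: $I_2=\{(\mu,\sigma):\mu\ge f_{\min},\ \mu-f_{\min}\le\sqrt2\,\sigma\}$ and $I_4=\{(\mu,\sigma):\mu\ge f_{\min},\ \mu-f_{\min}\ge\sqrt2\,\sigma\}$. The convex envelope of a function $g$ on an interval is the pointwise largest convex function on the interval that is $\le g$ there. *)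

theory Defs
  imports "HOL-Probability.Probability"
begin

definition std_normal_cdf :: "real \<Rightarrow> real" where
  "std_normal_cdf x = (LBINT t:{..x}. 1 / sqrt (2 * pi) * exp (- t\<^sup>2 / 2))"

text \<open>
  The intended domain is \<open>\<real> \<times> [0, \<infinity>)\<close>; the values for negative \<open>\<sigma>\<close> are irrelevant.
\<close>

definition prob_improvement :: "real \<Rightarrow> real \<times> real \<Rightarrow> real" where
  "prob_improvement fmin = (\<lambda>(\<mu>, \<sigma>).
     if \<sigma> > 0 then std_normal_cdf ((fmin - \<mu>) / \<sigma>)
     else if fmin \<le> \<mu> then 0 else 1)"

definition region_I2 :: "real \<Rightarrow> (real \<times> real) set" where
  "region_I2 fmin = {(\<mu>, \<sigma>). \<sigma> \<ge> 0 \<and> \<mu> \<ge> fmin \<and> \<mu> - fmin \<le> sqrt 2 * \<sigma>}"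

definition region_I4 :: "real \<Rightarrow> (real \<times> real) set" where
  "region_I4 fmin = {(\<mu>, \<sigma>). \<sigma> \<ge> 0 \<and> \<mu> \<ge> fmin \<and> \<mu> - fmin \<ge> sqrt 2 * \<sigma>}"

definition is_convex_relaxation ::
  "'a::real_vector set \<Rightarrow> ('a \<Rightarrow> real) \<Rightarrow> ('a \<Rightarrow> real) \<Rightarrow> bool" where
  "is_convex_relaxation S g h \<longleftrightarrow> convex_on S h \<and> (\<forall>x\<in>S. h x \<le> g x)"

definition is_convex_envelope ::
  "'a::real_vector set \<Rightarrow> ('a \<Rightarrow> real) \<Rightarrow> ('a \<Rightarrow> real) \<Rightarrow> bool" where
  "is_convex_envelope S g h \<longleftrightarrow>
     is_convex_relaxation S g h \<and>
     (\<forall>k. is_convex_relaxation S g k \<longrightarrow> (\<forall>x\<in>S. k x \<le> h x))"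

text \<open>
  An envelope is determined on \<open>S\<close> only, so the choice below affects nothing but
  the values outside \<open>S\<close>. It exists as soon as there is some convex function below \<open>g\<close>.
\<close>

definition convex_envelope ::
  "'a::real_vector set \<Rightarrow> ('a \<Rightarrow> real) \<Rightarrow> 'a \<Rightarrow> real" where
  "convex_envelope S g = (SOME h. is_convex_envelope S g h)"

lemma is_convex_envelope_unique:
  assumes "is_convex_envelope S g h" "is_convex_envelope S g h'" "x \<in> S"
  shows "h x = h' x"
  using assms unfolding is_convex_envelope_def by (meson order_antisym)

lemma is_convex_envelope_convex_envelope:
  assumes "is_convex_relaxation S g k0"
  shows "is_convex_envelope S g (convex_envelope S g)"
proof -
  define F where "F = {k. is_convex_relaxation S g k}"
  define h where "h = (\<lambda>x. SUP k\<in>F. k x)"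
  have ne: "F \<noteq> {}" using assms by (auto simp: F_def)
  have bdd: "bdd_above ((\<lambda>k. k x) ` F)" if "x \<in> S" for x
    using that by (auto simp: F_def is_convex_relaxation_def intro!: bdd_aboveI[of _ "g x"])
  have upper: "k x \<le> h x" if "k \<in> F" "x \<in> S" for k x
    unfolding h_def using that bdd by (intro cSUP_upper)
  have least: "h x \<le> g x" if "x \<in> S" for x
    unfolding h_def using that ne
    by (intro cSUP_least) (auto simp: F_def is_convex_relaxation_def)
  have "convex S"
    using assms by (auto simp: is_convex_relaxation_def convex_on_def)
  moreover have "h (u *\<^sub>R x + v *\<^sub>R y) \<le> u * h x + v * h y"
    if "x \<in> S" "y \<in> S" "0 \<le> u" "0 \<le> v" "u + v = 1" for x y u v
  proof (subst (1) h_def, rule cSUP_least[OF ne])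
    fix k assume k: "k \<in> F"
    have "k (u *\<^sub>R x + v *\<^sub>R y) \<le> u * k x + v * k y"
      using k that by (auto simp: F_def is_convex_relaxation_def convex_on_def)
    also have "\<dots> \<le> u * h x + v * h y"
      using k that by (intro add_mono mult_left_mono upper) auto
    finally show "k (u *\<^sub>R x + v *\<^sub>R y) \<le> u * h x + v * h y" .
  qed
  ultimately have "convex_on S h" by (auto simp: convex_on_def)
  then have "is_convex_envelope S g h"
    using least upper by (auto simp: is_convex_envelope_def is_convex_relaxation_def F_def)
  then show ?thesis unfolding convex_envelope_def by (rule someI[of "is_convex_envelope S g"])
qed

end

theory Submission
  imports Defs
begin

text \<open>
  For \<open>\<mu> \<ge> fmin\<close>, the function PI is antitone in \<open>\<mu>\<close> and monotone in \<open>\<sigma>\<close>, including at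
  \<open>\<sigma> = 0\<close>, where it takes its minimal value \<open>0\<close>. Hence restricting to the edge \<open>\<sigma> = sigL\<close> or to the
  edge \<open>\<mu> = muU\<close> of the box only decreases it, and each univariate envelope, extended constantly
  in the other variable, stays below PI.
\<close>

lemma std_normal_cdf_eq: "std_normal_cdf x = (LBINT t:{..x}. std_normal_density t)"
  by (simp add: std_normal_cdf_def std_normal_density_def)

lemma set_integrable_std_normal_density:
  "A \<in> sets borel \<Longrightarrow> set_integrable lborel A std_normal_density"
  unfolding set_integrable_def
  by (intro integrable_mult_indicator integrable_normal_density) auto

lemma std_normal_cdf_nonneg: "0 \<le> std_normal_cdf x"
  unfolding std_normal_cdf_eq set_lebesgue_integral_def
  by (intro integral_nonneg_AE) auto

text \<open>The density is nonnegative, so the integrands over the two half-lines are ordered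
  pointwise; both are integrable.\<close>

lemma std_normal_cdf_mono:
  assumes "x \<le> y"
  shows "std_normal_cdf x \<le> std_normal_cdf y"
  unfolding std_normal_cdf_eq set_lebesgue_integral_def
proof (rule integral_mono)
  show "indicat_real {..x} t *\<^sub>R std_normal_density t
      \<le> indicat_real {..y} t *\<^sub>R std_normal_density t" for t
    using assms by (auto simp: indicator_def)
qed (use set_integrable_std_normal_density in \<open>auto simp: set_integrable_def\<close>)

lemma prob_improvement_nonneg: "0 \<le> prob_improvement fmin p"
  by (auto simp: prob_improvement_def std_normal_cdf_nonneg split: prod.splits)

text \<open>For \<open>\<sigma> > 0\<close> the argument of the cdf decreases in the mean; otherwise
  the value is a step that drops from 1 to 0 at \<open>fmin\<close>.\<close>

lemma prob_improvement_antimono_mean: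
  assumes "\<mu> \<le> \<mu>'"
  shows "prob_improvement fmin (\<mu>', \<sigma>) \<le> prob_improvement fmin (\<mu>, \<sigma>)"
  using assms
  by (auto simp: prob_improvement_def intro!: std_normal_cdf_mono divide_right_mono)

text \<open>The numerator \<open>fmin - \<mu>\<close> is nonpositive, so a larger positive divisor
  moves the quotient up towards 0. If \<open>\<sigma> \<le> 0\<close>, the left side is 0.\<close>

lemma prob_improvement_mono_stddev:
  assumes "fmin \<le> \<mu>" "\<sigma> \<le> \<sigma>'"
  shows "prob_improvement fmin (\<mu>, \<sigma>) \<le> prob_improvement fmin (\<mu>, \<sigma>')"
  using assms
  by (auto simp: prob_improvement_def
      intro!: std_normal_cdf_mono std_normal_cdf_nonneg divide_left_mono_neg)

lemma convex_on_fst: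
  assumes "convex_on A f" "convex B"
  shows "convex_on (A \<times> B) (\<lambda>p. f (fst p))"
  using assms by (auto simp: convex_on_def convex_Times)

lemma convex_on_snd:
  assumes "convex A" "convex_on B f"
  shows "convex_on (A \<times> B) (\<lambda>p. f (snd p))"
  using assms by (auto simp: convex_on_def convex_Times)

lemma convex_on_max:
  fixes f g :: "'a::real_vector \<Rightarrow> real"
  assumes "convex_on S f" "convex_on S g"
  shows "convex_on S (\<lambda>x. max (f x) (g x))"
proof (rule convex_onI)
  show "convex S"
    using assms(1) by (rule convex_on_imp_convex)
next
  fix t :: real and x y
  assume t: "0 < t" "t < 1" and xy: "x \<in> S" "y \<in> S"
  \<comment> \<open>Stated for any convex \<open>h\<close> below the maximum at both endpoints, so
    that one argument serves \<open>f\<close> and \<open>g\<close> alike.\<close>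
  have "h ((1 - t) *\<^sub>R x + t *\<^sub>R y) \<le> (1 - t) * max (f x) (g x) + t * max (f y) (g y)"
    if h: "convex_on S h" "h x \<le> max (f x) (g x)" "h y \<le> max (f y) (g y)" for h
  proof -
    have "h ((1 - t) *\<^sub>R x + t *\<^sub>R y) \<le> (1 - t) * h x + t * h y"
      using convex_onD[OF h(1)] t xy by simp
    also have "\<dots> \<le> (1 - t) * max (f x) (g x) + t * max (f y) (g y)"
      using t h by (intro add_mono mult_left_mono) auto
    finally show ?thesis .
  qed
  from this[OF assms(1)] this[OF assms(2)]
  show "max (f ((1 - t) *\<^sub>R x + t *\<^sub>R y)) (g ((1 - t) *\<^sub>R x + t *\<^sub>R y))
      \<le> (1 - t) * max (f x) (g x) + t * max (f y) (g y)"
    by simp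
qed

text \<open>The constant \<open>c\<close> is a convex minorant, so an envelope exists and the choice
  in \<open>convex_envelope\<close> really picks one.\<close>

lemma is_convex_relaxation_convex_envelope:
  assumes "convex S" "\<And>x. x \<in> S \<Longrightarrow> c \<le> g x"
  shows "is_convex_relaxation S g (convex_envelope S g)"
proof -
  have "is_convex_relaxation S g (\<lambda>_. c)"
    using assms by (simp add: is_convex_relaxation_def convex_on_const)
  from is_convex_envelope_convex_envelope[OF this]
  show ?thesis by (simp add: is_convex_envelope_def)
qed

theorem mainTheorem4:
  fixes fmin muL muU sigL sigU :: real
    and X :: "(real \<times> real) set"
    and f_sigL f_muU :: "real \<Rightarrow> real"
    and PIcv :: "real \<times> real \<Rightarrow> real"
  assumes "muL \<le> muU" and "sigL \<le> sigU"
    and "X = {muL..muU} \<times> {sigL..sigU}"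
    and "X \<subseteq> UNIV \<times> {0..}"
    and "X \<subseteq> region_I2 fmin \<union> region_I4 fmin"
    and "f_sigL = (\<lambda>\<mu>. prob_improvement fmin (\<mu>, sigL))"
    and "f_muU = (\<lambda>\<sigma>. prob_improvement fmin (muU, \<sigma>))"
    and "PIcv = (\<lambda>(\<mu>, \<sigma>).
           max (convex_envelope {muL..muU} f_sigL \<mu>)
               (convex_envelope {sigL..sigU} f_muU \<sigma>))"
  shows "is_convex_relaxation X (prob_improvement fmin) PIcv"
proof -
  have A: "is_convex_relaxation {muL..muU} f_sigL (convex_envelope {muL..muU} f_sigL)"
    and B: "is_convex_relaxation {sigL..sigU} f_muU (convex_envelope {sigL..sigU} f_muU)"
    \<comment> \<open>The constant 0 serves as the minorant, since PI is nonnegative.\<close>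
    using assms(6,7)
    by (auto intro!: is_convex_relaxation_convex_envelope[where c = 0] prob_improvement_nonneg)
  have "convex_on X PIcv"
    \<comment> \<open>\<open>case_prod_beta\<close> turns the pair pattern into \<open>fst\<close>
      and \<open>snd\<close>, the form in which univariate convexity lifts to the box.\<close>
    using A B unfolding assms(3,8) is_convex_relaxation_def case_prod_beta
    by (intro convex_on_max convex_on_fst convex_on_snd) auto
  moreover have "PIcv p \<le> prob_improvement fmin p" if "p \<in> X" for p
  proof -
    obtain \<mu> \<sigma> where p: "p = (\<mu>, \<sigma>)" by (cases p)
    have in_box: "\<mu> \<in> {muL..muU}" "\<sigma> \<in> {sigL..sigU}"
      using that p assms(3) by auto
    \<comment> \<open>Both regions lie in this half-plane; it is what makes PI monotone in
      \<open>\<sigma>\<close>.\<close>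
    have "fmin \<le> \<mu>"
      using that assms(5) unfolding p region_I2_def region_I4_def by auto
    have "convex_envelope {muL..muU} f_sigL \<mu> \<le> prob_improvement fmin (\<mu>, sigL)"
      using A in_box assms(6) by (simp add: is_convex_relaxation_def)
    also have "\<dots> \<le> prob_improvement fmin p"
      using prob_improvement_mono_stddev \<open>fmin \<le> \<mu>\<close> in_box p by simp
    finally have 1: "convex_envelope {muL..muU} f_sigL \<mu> \<le> prob_improvement fmin p" .
    have "convex_envelope {sigL..sigU} f_muU \<sigma> \<le> prob_improvement fmin (muU, \<sigma>)"
      using B in_box assms(7) by (simp add: is_convex_relaxation_def)
    also have "\<dots> \<le> prob_improvement fmin p"
      using prob_improvement_antimono_mean in_box p by simp
    finally show ?thesis
      using 1 p assms(8) by simp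
  qed
  ultimately show ?thesis
    by (simp add: is_convex_relaxation_def)
qed

end
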